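(* Let $a\ge 1$ and $b\ge 1$ be integers, and let $K(a,b)$ be the complete multipartite graph with $b$ parts, each having $a$ vertices. Then $$\theta(K(a,b))=\begin{cases}0 & \text{if } a \text{ is even, or } a \text{ and } b \text{ are both odd},\\ 1 & \text{if } a \text{ is odd and } b \text{ is even, except when } a\equiv 1 \pmod 4 \text{ and } b=2.\end{cases}$$
   Context: All graphs are simple and finite; $N(u)$ denotes the set of vertices adjacent to $u$. Let $G$ be a graph on $n$ vertices and $S$ a set of $n$ (distinct) positive integers. $G$ is $S$-magic if there is a bijection $l:V(G)\to S$ and a constant $\mu'$ such that $\sum_{v\in N(u)}l(v)=\mu'$ for every vertex $u$ of $G$. Let $\eta(S)$ denote the largest element of $S$, and let $i(G)$ be the infimum of $\eta(S)$ over all sets $S$ of $n$ positive integers for which $G$ is $S$-magic. The distance magic index of $G$ is $\theta(G)=i(G)-n$ (it is infinite if $G$ is not $S$-magic for any $S$). The exceptional case in the second line is excluded from the assertion (nothing is claimed there).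
   Formalization: The case a = 1 with b ≥ 2 is excluded: there K(1,b) is the complete graph on b vertices, which is not S-magic for any S, so its index is infinite and the claimed value 0 or 1 fails for b ≥ 3 (b = 2 was already excepted). *)

theory Defs
  imports "HOL-Library.Extended_Real"
begin

record 'v sgraph =
  verts :: "'v set"
  edges :: "'v set set"

definition simple_graph :: "'v sgraph \<Rightarrow> bool" where
  "simple_graph G \<longleftrightarrow> finite (verts G) \<and> (\<forall>e\<in>edges G. e \<subseteq> verts G \<and> card e = 2)"

(* No vertex of a simple graph belongs to its own neighbourhood, since {u, u} has one element. *)
definition nbhd :: "'v sgraph \<Rightarrow> 'v \<Rightarrow> 'v set" where
  "nbhd G u = {v. {u, v} \<in> edges G}"

definition S_magic :: "'v sgraph \<Rightarrow> nat set \<Rightarrow> bool" where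
  "S_magic G S \<longleftrightarrow>
     (\<exists>l \<mu>'. bij_betw l (verts G) S \<and> (\<forall>u\<in>verts G. (\<Sum>v\<in>nbhd G u. l v) = \<mu>'))"

definition magic_label_sets :: "'v sgraph \<Rightarrow> nat set set" where
  "magic_label_sets G =
     {S. finite S \<and> card S = card (verts G) \<and> (\<forall>s\<in>S. 0 < s) \<and> S_magic G S}"

(* The paper's eta(S) is Max S.  The infimum of the empty set is infinity.  Both this and Max are
   meaningful only for graphs with at least one vertex. *)
definition magic_inf :: "'v sgraph \<Rightarrow> ereal" where
  "magic_inf G = (INF S\<in>magic_label_sets G. ereal (real (Max S)))"

definition distance_magic_index :: "'v sgraph \<Rightarrow> ereal" where
  "distance_magic_index G = magic_inf G - ereal (real (card (verts G)))"

(* The vertex (i, j) is the j-th vertex of the i-th part. *)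
definition complete_multipartite :: "nat \<Rightarrow> nat \<Rightarrow> (nat \<times> nat) sgraph" where
  "complete_multipartite a b =
     \<lparr> verts = {..<b} \<times> {..<a},
       edges = {{(i, j), (i', j')} | i j i' j'.
                  i < b \<and> j < a \<and> i' < b \<and> j' < a \<and> i \<noteq> i'} \<rparr>"

lemma simple_graph_complete_multipartite: "simple_graph (complete_multipartite a b)"
  by (auto simp: simple_graph_def complete_multipartite_def)

lemma card_verts_complete_multipartite: "card (verts (complete_multipartite a b)) = a * b"
  by (simp add: complete_multipartite_def)

lemma nbhd_complete_multipartite:
  assumes "i < b" "j < a"
  shows "nbhd (complete_multipartite a b) (i, j) = ({..<b} - {i}) \<times> {..<a}"
  using assms by (auto simp: nbhd_def complete_multipartite_def doubleton_eq_iff)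

(* With parts of size 1 the graph is the complete graph on b vertices.  Two adjacent vertices with
   the same closed neighbourhood would need equal labels, so for b at least 2 it is not S-magic
   for any S. *)
lemma distance_magic_index_complete_graph:
  assumes "b \<ge> 2"
  shows "distance_magic_index (complete_multipartite 1 b) = \<infinity>"
proof -
  let ?G = "complete_multipartite 1 b"
  have "\<not> S_magic ?G S" for S
  proof
    assume "S_magic ?G S"
    then obtain l m where bij: "bij_betw l (verts ?G) S"
      and m: "\<And>u. u \<in> verts ?G \<Longrightarrow> (\<Sum>v\<in>nbhd ?G u. l v) = m"
      unfolding S_magic_def by blast
    have V: "verts ?G = {..<b} \<times> {..<1}"
      by (simp add: complete_multipartite_def)
    have tot: "(\<Sum>v\<in>verts ?G. l v) = l (i, 0) + m" if "i < b" for i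
    proof -
      have "verts ?G = insert (i, 0) (nbhd ?G (i, 0))"
        using that nbhd_complete_multipartite[of i b 0 1] unfolding V by auto
      moreover have "finite (nbhd ?G (i, 0))" "(i, 0) \<notin> nbhd ?G (i, 0)"
        using that nbhd_complete_multipartite[of i b 0 1] by auto
      ultimately show ?thesis
        using m[of "(i, 0)"] by (metis insertI1 sum.insert)
    qed
    have "l (0, 0) = l (1, 0)"
      using tot[of 0] tot[of 1] assms by simp
    moreover have "(0, 0) \<in> verts ?G" "(1, 0) \<in> verts ?G"
      using assms unfolding V by auto
    ultimately show False
      using bij unfolding bij_betw_def inj_on_def by (metis Pair_inject zero_neq_one)
  qed
  then show ?thesis
    by (simp add: distance_magic_index_def magic_inf_def magic_label_sets_def top_ereal_def)
qed

end

theory Submission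
  imports Defs
begin

text \<open>
  In a complete multipartite graph the neighbourhood of a vertex is the complement of its part.
  Hence a labelling is magic exactly when all parts have the same label sum, and \<open>K(a,b)\<close> is
  \<open>S\<close>-magic exactly when the elements of \<open>S\<close> fill a \<open>b \<times> a\<close> array with equal row sums
  (\<open>S_magic_complete_multipartite_iff\<close>).

  Since \<open>S\<close> consists of \<open>a * b\<close> positive integers, its maximum is at least \<open>a * b\<close>, with equality only
  for \<open>S = {1..a * b}\<close>.  If \<open>a\<close> is odd and \<open>b\<close> is even, then that set is ruled out by parity: twice the
  common row sum would be the odd number \<open>a * (a * b + 1)\<close>.  It remains to construct arrays.

  An array with entries at most \<open>N\<close> can be widened by two columns filled with \<open>N + 1, \<dots>, N + 2 * b\<close>,
  one in increasing and one in decreasing order (\<open>equal_row_sums_add_two_columns\<close>).  So it is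
  enough to treat widths \<open>0\<close> and \<open>3\<close>, and \<open>a = b = 1\<close>.  For width \<open>3\<close> let \<open>\<tau>\<close> be a
  perfect shuffle of \<open>{0..<b}\<close>.  Its displacements \<open>\<tau> p - p\<close> are all the integers from \<open>-k\<close> to \<open>k\<close> if
  \<open>b = 2 * k + 1\<close>, and all of these but \<open>0\<close> if \<open>b = 2 * k\<close>.  So \<open>p\<close>, the displacement \<open>\<tau> p - p\<close> and
  \<open>- \<tau> p\<close>, which add up to zero, give three columns that after suitable shifts cover
  \<open>{1..3 * b}\<close> if \<open>b\<close> is odd, and \<open>{1..3 * b + 1}\<close> without its middle element if \<open>b\<close> is even.
\<close>

section \<open>Arrays with equal row sums\<close>

text \<open>
  The set \<open>S\<close> can be arranged, each element being used once, in \<open>b\<close> rows of \<open>a\<close> entries with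
  a common row sum.  The row index comes first, as for the vertices of \<open>complete_multipartite a b\<close>.
\<close>

definition equal_row_sums :: "nat \<Rightarrow> nat \<Rightarrow> nat set \<Rightarrow> bool" where
  "equal_row_sums a b S \<longleftrightarrow>
     (\<exists>f r. bij_betw f ({..<b} \<times> {..<a}) S \<and> (\<forall>i<b. (\<Sum>j<a. f (i, j)) = r))"

lemma equal_row_sumsI:
  assumes "\<And>i j. i < b \<Longrightarrow> j < a \<Longrightarrow> f (i, j) \<in> S"
    and "\<And>i j i' j'. \<lbrakk>i < b; j < a; i' < b; j' < a; f (i, j) = f (i', j')\<rbrakk> \<Longrightarrow> i = i' \<and> j = j'"
    and "finite S" "card S = a * b"
    and "\<And>i. i < b \<Longrightarrow> (\<Sum>j<a. f (i, j)) = r"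
  shows "equal_row_sums a b S"
proof -
  have inj: "inj_on f ({..<b} \<times> {..<a})"
    using assms(2) by (fastforce simp: inj_on_def)
  have "f ` ({..<b} \<times> {..<a}) = S"
  proof (rule card_subset_eq)
    show "f ` ({..<b} \<times> {..<a}) \<subseteq> S"
      using assms(1) by auto
    show "card (f ` ({..<b} \<times> {..<a})) = card S"
      using inj assms(4) by (simp add: card_image)
  qed (fact assms(3))
  with inj assms(5) show ?thesis
    unfolding equal_row_sums_def bij_betw_def by blast
qed

lemma equal_row_sums_add_two_columns:
  assumes "equal_row_sums a b S" "S \<subseteq> {..N}"
  shows "equal_row_sums (a + 2) b (S \<union> {N + 1..N + 2 * b})"
proof -
  obtain f r where f: "bij_betw f ({..<b} \<times> {..<a}) S"
    and r: "\<And>i. i < b \<Longrightarrow> (\<Sum>j<a. f (i, j)) = r"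
    using assms(1) unfolding equal_row_sums_def by blast
  have S: "f (i, j) \<in> S" if "i < b" "j < a" for i j
    using f that by (auto simp: bij_betw_def)
  have le: "f (i, j) \<le> N" if "i < b" "j < a" for i j
    using S[OF that] assms(2) by auto
  have inj: "i = i' \<and> j = j'"
    if "i < b" "j < a" "i' < b" "j' < a" "f (i, j) = f (i', j')" for i j i' j'
    using bij_betw_imp_inj_on[OF f] that by (auto dest!: inj_onD)
  have fin: "finite S"
    using assms(2) finite_subset by blast
  have cardS: "card S = a * b"
    using bij_betw_same_card[OF f] by (simp add: mult.commute)
  define g where "g = (\<lambda>(i, j). if j < a then f (i, j) else if j = a then N + 1 + i else N + 2 * b - i)"
  show ?thesis
  proof (rule equal_row_sumsI[where f = g and r = "r + (2 * N + 1 + 2 * b)"])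
    show "g (i, j) \<in> S \<union> {N + 1..N + 2 * b}" if "i < b" "j < a + 2" for i j
      using that S by (auto simp: g_def)
    show "i = i' \<and> j = j'"
      if "i < b" "j < a + 2" "i' < b" "j' < a + 2" "g (i, j) = g (i', j')" for i j i' j'
      using that inj[of i j i' j'] le[of i j] le[of i' j']
      by (auto simp: g_def split: if_splits)
    show "finite (S \<union> {N + 1..N + 2 * b})"
      using fin by simp
    have "S \<inter> {N + 1..N + 2 * b} = {}"
      using assms(2) by auto
    then show "card (S \<union> {N + 1..N + 2 * b}) = (a + 2) * b"
      using fin cardS by (simp add: card_Un_disjoint)
    show "(\<Sum>j<a + 2. g (i, j)) = r + (2 * N + 1 + 2 * b)" if "i < b" for i
      using r[OF that] that by (simp add: g_def)
  qed
qed

lemma equal_row_sums_widen: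
  assumes "equal_row_sums a b S" "S \<subseteq> {..N}"
  shows "equal_row_sums (a + 2 * t) b (S \<union> {N + 1..N + 2 * t * b})"
proof (induction t)
  case 0
  then show ?case using assms(1) by simp
next
  case (Suc t)
  let ?M = "N + 2 * t * b"
  have "S \<union> {N + 1..?M} \<subseteq> {..?M}"
    using assms(2) by auto
  from equal_row_sums_add_two_columns[OF Suc this]
  have "equal_row_sums (a + 2 * t + 2) b ((S \<union> {N + 1..?M}) \<union> {?M + 1..?M + 2 * b})" .
  moreover have "(S \<union> {N + 1..?M}) \<union> {?M + 1..?M + 2 * b} = S \<union> {N + 1..N + 2 * Suc t * b}"
    by (auto simp: algebra_simps)
  ultimately show ?case by simp
qed

section \<open>Three columns from a perfect shuffle\<close>

text \<open>
  The shuffle sends \<open>p\<close> to \<open>2 * p\<close> for \<open>p \<le> k\<close> and to \<open>2 * (p - k) - 1\<close> for \<open>p > k\<close>, so the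
  displacements are \<open>0, \<dots>, k\<close> on the first part and \<open>-k, \<dots>, -1\<close> on the second.  The columns
  are \<open>p + 1\<close>, the displacement plus \<open>3 * k + 2\<close>, and \<open>6 * k + 3\<close> minus the image of \<open>p\<close>.
\<close>

lemma equal_row_sums_three_odd:
  assumes "odd b"
  shows "equal_row_sums 3 b {1..3 * b}"
proof -
  obtain k where b: "b = 2 * k + 1"
    using assms by (auto elim: oddE)
  define f where "f = (\<lambda>(p, j :: nat).
     if j = 0 then p + 1
     else if p \<le> k then (if j = 1 then 3 * k + 2 + p else 6 * k + 3 - 2 * p)
     else (if j = 1 then k + 1 + p else 8 * k + 4 - 2 * p))"
  show ?thesis
  proof (rule equal_row_sumsI[where f = f and r = "9 * k + 6"])
    show "f (p, j) \<in> {1..3 * b}" if "p < b" "j < 3" for p j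
      using that unfolding f_def b by auto
    show "p = p' \<and> j = j'"
      if "p < b" "j < 3" "p' < b" "j' < 3" "f (p, j) = f (p', j')" for p j p' j'
    proof -
      have "j = 0 \<or> j = 1 \<or> j = 2" "j' = 0 \<or> j' = 1 \<or> j' = 2"
        using that by auto
      then show ?thesis
        using that unfolding f_def b by (elim disjE; simp split: if_splits; presburger)
    qed
    show "(\<Sum>j<3. f (p, j)) = 9 * k + 6" if "p < b" for p
      using that unfolding f_def b by (simp add: numeral_3_eq_3)
  qed simp_all
qed

text \<open>
  The shuffle sends \<open>p\<close> to \<open>2 * p + 1\<close> for \<open>p < k\<close> and to \<open>2 * (p - k)\<close> for \<open>p \<ge> k\<close>, so the
  displacements are \<open>1, \<dots>, k\<close> on the first part and \<open>-k, \<dots>, -1\<close> on the second.  The columns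
  are \<open>p + 1\<close>, the displacement plus \<open>3 * k + 1\<close>, and \<open>6 * k + 1\<close> minus the image of \<open>p\<close>;
  the value \<open>3 * k + 1\<close> is left out because no point is fixed.
\<close>

lemma equal_row_sums_three_even:
  shows "equal_row_sums 3 (2 * k) ({1..6 * k + 1} - {3 * k + 1})"
proof -
  define f where "f = (\<lambda>(p, j :: nat).
     if j = 0 then p + 1
     else if p < k then (if j = 1 then 3 * k + 2 + p else 6 * k - 2 * p)
     else (if j = 1 then k + 1 + p else 8 * k + 1 - 2 * p))"
  show ?thesis
  proof (rule equal_row_sumsI[where f = f and r = "9 * k + 3"])
    show "f (p, j) \<in> {1..6 * k + 1} - {3 * k + 1}" if "p < 2 * k" "j < 3" for p j
      using that unfolding f_def by auto
    show "p = p' \<and> j = j'"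
      if "p < 2 * k" "j < 3" "p' < 2 * k" "j' < 3" "f (p, j) = f (p', j')" for p j p' j'
    proof -
      have "j = 0 \<or> j = 1 \<or> j = 2" "j' = 0 \<or> j' = 1 \<or> j' = 2"
        using that by auto
      then show ?thesis
        using that unfolding f_def by (elim disjE; simp split: if_splits; presburger)
    qed
    show "(\<Sum>j<3. f (p, j)) = 9 * k + 3" if "p < 2 * k" for p
      using that unfolding f_def by (simp add: numeral_3_eq_3)
  qed simp_all
qed

section \<open>Arrays of arbitrary width\<close>

lemma equal_row_sums_even_width:
  assumes "even a"
  shows "equal_row_sums a b {1..a * b}"
proof -
  obtain t where t: "a = 2 * t"
    using assms by blast
  have "equal_row_sums 0 b {}"
    by (simp add: equal_row_sums_def bij_betw_def)
  from equal_row_sums_widen[OF this, of 0 t] show ?thesis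
    by (simp add: t)
qed

lemma odd_eq_3_plus_even:
  fixes a :: nat
  assumes "odd a" "a \<noteq> 1"
  obtains t where "a = 3 + 2 * t"
proof -
  obtain c where c: "a = 2 * c + 1"
    using assms(1) by (rule oddE)
  with assms(2) have "a = 3 + 2 * (c - 1)"
    by simp
  then show ?thesis ..
qed

lemma equal_row_sums_odd_odd:
  assumes "odd a" "odd b" "a = 1 \<Longrightarrow> b = 1"
  shows "equal_row_sums a b {1..a * b}"
proof (cases "a = 1")
  case True
  then have "equal_row_sums a b {1}"
    using assms(3) by (intro equal_row_sumsI[where f = "\<lambda>_. 1" and r = 1]) auto
  with True assms(3) show ?thesis by simp
next
  case False
  with assms(1) obtain t where t: "a = 3 + 2 * t"
    by (rule odd_eq_3_plus_even)
  have "equal_row_sums a b ({1..3 * b} \<union> {3 * b + 1..3 * b + 2 * t * b})"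
    unfolding t using equal_row_sums_three_odd[OF assms(2)] by (rule equal_row_sums_widen) auto
  also have "{1..3 * b} \<union> {3 * b + 1..3 * b + 2 * t * b} = {1..a * b}"
    by (auto simp: t algebra_simps)
  finally show ?thesis .
qed

lemma equal_row_sums_odd_even:
  assumes "odd a" "a \<noteq> 1" "even b"
  obtains S where "S \<subseteq> {1..a * b + 1}" "equal_row_sums a b S"
proof -
  obtain k where k: "b = 2 * k"
    using assms(3) by blast
  obtain t where t: "a = 3 + 2 * t"
    using assms(1,2) by (rule odd_eq_3_plus_even)
  let ?T = "{1..6 * k + 1} - {3 * k + 1}"
  let ?S = "?T \<union> {6 * k + 1 + 1..6 * k + 1 + 2 * t * b}"
  have "equal_row_sums a b ?S"
    unfolding t k using equal_row_sums_three_even by (rule equal_row_sums_widen) auto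
  moreover have "?S \<subseteq> {1..a * b + 1}"
    by (auto simp: t k algebra_simps)
  ultimately show ?thesis
    using that by blast
qed

section \<open>Magic labellings of complete multipartite graphs\<close>

lemma S_magic_complete_multipartite_iff:
  assumes "a \<ge> 1"
  shows "S_magic (complete_multipartite a b) S \<longleftrightarrow> equal_row_sums a b S"
proof -
  let ?G = "complete_multipartite a b"
  have V: "verts ?G = {..<b} \<times> {..<a}"
    by (simp add: complete_multipartite_def)
  have total: "(\<Sum>v\<in>verts ?G. l v) = (\<Sum>j<a. l (i, j)) + (\<Sum>v\<in>nbhd ?G (i, j'). l v)"
    if "i < b" "j' < a" for i j' and l :: "nat \<times> nat \<Rightarrow> nat"
  proof -
    have "verts ?G = Pair i ` {..<a} \<union> nbhd ?G (i, j')"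
      using that by (auto simp: V nbhd_complete_multipartite)
    moreover have "Pair i ` {..<a} \<inter> nbhd ?G (i, j') = {}" "finite (nbhd ?G (i, j'))"
      using that by (auto simp: nbhd_complete_multipartite)
    ultimately have "(\<Sum>v\<in>verts ?G. l v)
        = (\<Sum>v\<in>Pair i ` {..<a}. l v) + (\<Sum>v\<in>nbhd ?G (i, j'). l v)"
      by (simp add: sum.union_disjoint)
    also have "(\<Sum>v\<in>Pair i ` {..<a}. l v) = (\<Sum>j<a. l (i, j))"
      by (simp add: sum.reindex inj_on_def)
    finally show ?thesis .
  qed
  show ?thesis
  proof
    assume "S_magic ?G S"
    then obtain l m where l: "bij_betw l (verts ?G) S"
      and m: "\<And>u. u \<in> verts ?G \<Longrightarrow> (\<Sum>v\<in>nbhd ?G u. l v) = m"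
      unfolding S_magic_def by blast
    have "(\<Sum>j<a. l (i, j)) = (\<Sum>v\<in>verts ?G. l v) - m" if "i < b" for i
      using total[of i 0 l] m[of "(i, 0)"] that assms by (simp add: V)
    with l show "equal_row_sums a b S"
      unfolding equal_row_sums_def V by blast
  next
    assume "equal_row_sums a b S"
    then obtain l r where l: "bij_betw l (verts ?G) S"
      and r: "\<And>i. i < b \<Longrightarrow> (\<Sum>j<a. l (i, j)) = r"
      unfolding equal_row_sums_def V by blast
    have "(\<Sum>v\<in>nbhd ?G (i, j). l v) = (\<Sum>v\<in>verts ?G. l v) - r" if "i < b" "j < a" for i j
      using total[OF that, of l] r[OF that(1)] by simp
    then have "\<forall>u\<in>verts ?G. (\<Sum>v\<in>nbhd ?G u. l v) = (\<Sum>v\<in>verts ?G. l v) - r"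
      by (auto simp: V)
    with l show "S_magic ?G S"
      unfolding S_magic_def by blast
  qed
qed

lemma not_equal_row_sums_odd_even:
  assumes "odd a" "even b" "b \<ge> 1"
  shows "\<not> equal_row_sums a b {1..a * b}"
proof
  assume "equal_row_sums a b {1..a * b}"
  then obtain f r where f: "bij_betw f ({..<b} \<times> {..<a}) {1..a * b}"
    and r: "\<And>i. i < b \<Longrightarrow> (\<Sum>j<a. f (i, j)) = r"
    unfolding equal_row_sums_def by blast
  have "\<Sum>{1..a * b} = (\<Sum>v\<in>{..<b} \<times> {..<a}. f v)"
    using sum.reindex_bij_betw[OF f, of "\<lambda>x. x"] by simp
  also have "\<dots> = (\<Sum>i<b. \<Sum>j<a. f (i, j))"
    by (simp add: sum.cartesian_product)
  also have "\<dots> = b * r"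
    using r by simp
  finally have "2 * (b * r) = 2 * \<Sum>{1..a * b}"
    by simp
  also have "\<dots> = a * b * (a * b + 1)"
    using double_gauss_sum_from_Suc_0[of "a * b", where 'a = nat] by simp
  finally have "b * (2 * r) = b * (a * (a * b + 1))"
    by (simp add: algebra_simps)
  then have "2 * r = a * (a * b + 1)"
    using assms(3) by simp
  moreover have "odd (a * (a * b + 1))"
    using assms(1,2) by simp
  ultimately show False
    by (metis dvd_triv_left)
qed

section \<open>The distance magic index\<close>

lemma finite_positive_subset_Max:
  fixes S :: "nat set"
  assumes "finite S" "\<forall>s\<in>S. 0 < s"
  shows "S \<subseteq> {1..Max S}"
  using assms by (auto simp: Suc_le_eq)

lemma card_le_Max_of_positive:
  fixes S :: "nat set"
  assumes "finite S" "\<forall>s\<in>S. 0 < s"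
  shows "card S \<le> Max S"
  using card_mono[OF _ finite_positive_subset_Max[OF assms]] by simp

lemma distance_magic_index_complete_multipartite_eqI:
  assumes "a \<ge> 1" "b \<ge> 1"
    and "S \<subseteq> {1..a * b + d}" "equal_row_sums a b S"
    and lower: "\<And>T. \<lbrakk>finite T; card T = a * b; \<forall>s\<in>T. 0 < s; equal_row_sums a b T\<rbrakk>
                 \<Longrightarrow> a * b + d \<le> Max T"
  shows "distance_magic_index (complete_multipartite a b) = ereal (real d)"
proof -
  let ?G = "complete_multipartite a b"
  have sets: "magic_label_sets ?G
      = {T. finite T \<and> card T = a * b \<and> (\<forall>s\<in>T. 0 < s) \<and> equal_row_sums a b T}"
    using assms(1) by (simp add: magic_label_sets_def card_verts_complete_multipartite
        S_magic_complete_multipartite_iff)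
  have fin: "finite S"
    using assms(3) finite_subset by blast
  have cardS: "card S = a * b"
    using assms(4) by (auto simp: equal_row_sums_def mult.commute dest!: bij_betw_same_card)
  then have "S \<noteq> {}"
    using assms(1,2) by auto
  then have "Max S \<le> a * b + d"
    using assms(3) fin Max_in by fastforce
  moreover have S: "S \<in> magic_label_sets ?G"
    using assms(3,4) fin cardS by (auto simp: sets)
  ultimately have "magic_inf ?G \<le> ereal (real (a * b + d))"
    unfolding magic_inf_def by (intro INF_lower2[OF S]) (simp del: of_nat_add of_nat_mult)
  moreover have "ereal (real (a * b + d)) \<le> magic_inf ?G"
    unfolding magic_inf_def
    by (rule INF_greatest) (use lower in \<open>auto simp: sets simp del: of_nat_add of_nat_mult\<close>)
  ultimately have "magic_inf ?G = ereal (real (a * b + d))"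
    by (rule antisym)
  then show ?thesis
    by (simp add: distance_magic_index_def card_verts_complete_multipartite)
qed

theorem theorem3p1:
  fixes a b :: nat
  assumes "a \<ge> 1" and "b \<ge> 1"
    and not_complete_graph: "\<not> (a = 1 \<and> b \<ge> 2)"
  shows "(even a \<or> (odd a \<and> odd b) \<longrightarrow>
            distance_magic_index (complete_multipartite a b) = 0) \<and>
         (odd a \<and> even b \<and> \<not> (a mod 4 = 1 \<and> b = 2) \<longrightarrow>
            distance_magic_index (complete_multipartite a b) = 1)"
proof (intro conjI impI)
  assume "even a \<or> (odd a \<and> odd b)"
  moreover have "a = 1 \<Longrightarrow> b = 1"
    using assms by simp
  ultimately have "equal_row_sums a b {1..a * b}"
    using equal_row_sums_even_width equal_row_sums_odd_odd by blast
  then have "distance_magic_index (complete_multipartite a b) = ereal (real 0)"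
    using assms(1,2) by (intro distance_magic_index_complete_multipartite_eqI)
      (auto dest!: card_le_Max_of_positive)
  then show "distance_magic_index (complete_multipartite a b) = 0"
    by simp
next
  assume "odd a \<and> even b \<and> \<not> (a mod 4 = 1 \<and> b = 2)"
  then have "odd a" "even b"
    by auto
  moreover from \<open>even b\<close> have "a \<noteq> 1"
    using assms by (cases "b = 1") auto
  ultimately obtain S where S: "S \<subseteq> {1..a * b + 1}" "equal_row_sums a b S"
    by (elim equal_row_sums_odd_even)
  have "a * b + 1 \<le> Max T"
    if T: "finite T" "card T = a * b" "\<forall>s\<in>T. 0 < s" "equal_row_sums a b T" for T
  proof (rule ccontr)
    assume "\<not> a * b + 1 \<le> Max T"
    with card_le_Max_of_positive[OF T(1,3)] T(2) have "Max T = a * b"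
      by simp
    then have "T = {1..a * b}"
      using finite_positive_subset_Max[OF T(1,3)] T(2) by (intro card_subset_eq) auto
    with T(4) not_equal_row_sums_odd_even[OF \<open>odd a\<close> \<open>even b\<close> assms(2)] show False
      by simp
  qed
  with S assms(1,2)
  have "distance_magic_index (complete_multipartite a b) = ereal (real 1)"
    by (intro distance_magic_index_complete_multipartite_eqI)
  then show "distance_magic_index (complete_multipartite a b) = 1"
    by (simp add: one_ereal_def)
qed

end
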